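(* There is no conjugation $C$ on $L^2(\mathbb{T})$ such that $CM_{z^2}=M_{\bar z^2}C$ and $C(H^2)\subset H^2$.
   Context: $\mathbb{T}$ is the unit circle with normalized Lebesgue measure; $H^2\subset L^2(\mathbb{T})$ is the Hardy space (functions whose negative Fourier coefficients vanish). A conjugation on a Hilbert space $\mathcal{H}$ is an antilinear map $C:\mathcal{H}\to\mathcal{H}$ with $C^2=I$ and $\langle Cf,Cg\rangle=\langle g,f\rangle$ for all $f,g$. For $\phi\in L^\infty(\mathbb{T})$, $M_\phi f=\phi f$ on $L^2(\mathbb{T})$. *)

theory Defs
  imports "HOL-Analysis.Analysis"
begin

text \<open>Normalized arc length on the unit circle: the push-forward of the uniform distribution
  on \<open>[0, 2\<pi>)\<close> under \<open>t \<mapsto> e\<^sup>i\<^sup>t\<close>, as a measure on the Borel sets of the circle.\<close>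

definition circle :: "complex measure" where
  "circle = distr (uniform_measure lborel {0..<2 * pi}) (restrict_space borel (sphere 0 1)) cis"

lemma space_circle [simp]: "space circle = sphere 0 1"
  and sets_circle [measurable_cong, simp]: "sets circle = sets (restrict_space borel (sphere 0 1))"
  by (simp_all add: circle_def space_restrict_space)

lemma cis_measurable_circle [measurable]:
  "cis \<in> uniform_measure lborel {0..<2 * pi} \<rightarrow>\<^sub>M restrict_space borel (sphere 0 1)"
proof (intro measurable_restrict_space2)
  have "cis \<in> borel_measurable borel"
    by (intro borel_measurable_continuous_onI continuous_on_cis continuous_on_id)
  then show "cis \<in> borel_measurable (uniform_measure lborel {0..<2 * pi})"
    by (simp cong: measurable_cong_sets)
qed auto

lemma emeasure_space_circle: "emeasure circle (space circle) = 1"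
proof -
  have "sphere 0 1 \<in> sets circle"
    using sets.top[of circle] by simp
  moreover have "cis -` sphere 0 1 = UNIV"
    by auto
  ultimately show ?thesis
    by (simp add: circle_def emeasure_distr)
qed

lemma finite_measure_circle: "finite_measure circle"
  by (rule finite_measureI) (simp only: emeasure_space_circle, simp)

lemma continuous_measurable_circle:
  "continuous_on (sphere 0 1) h \<Longrightarrow> h \<in> borel_measurable circle"
  using borel_measurable_continuous_on_restrict[of "sphere 0 1" h]
  by (simp cong: measurable_cong_sets)

lemma powi_measurable_circle: "(\<lambda>z. z powi n) \<in> borel_measurable circle"
  by (intro continuous_measurable_circle continuous_intros) auto

lemma cnj_measurable [measurable]: "cnj \<in> borel_measurable borel"
  by (intro borel_measurable_continuous_onI continuous_intros)

text \<open>Functions here are total on \<^typ>\<open>complex\<close>; only their values on the circle matter.\<close>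

definition square_integrable :: "(complex \<Rightarrow> complex) \<Rightarrow> bool" where
  "square_integrable f \<longleftrightarrow>
     f \<in> borel_measurable circle \<and> integrable circle (\<lambda>z. (cmod (f z))\<^sup>2)"

definition Linf :: "(complex \<Rightarrow> complex) set" where
  "Linf = {\<phi>. \<phi> \<in> borel_measurable circle \<and> (\<exists>B. AE z in circle. cmod (\<phi> z) \<le> B)}"

lemma square_integrable_measurable [measurable_dest]:
  "square_integrable f \<Longrightarrow> f \<in> borel_measurable circle"
  by (simp add: square_integrable_def)

lemma square_integrable_zero: "square_integrable (\<lambda>_. 0)"
  by (simp add: square_integrable_def)

lemma square_integrable_add:
  assumes f: "square_integrable f" and g: "square_integrable g"
  shows "square_integrable (\<lambda>z. f z + g z)"
proof -
  note [measurable] = square_integrable_measurable[OF f] square_integrable_measurable[OF g]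
  have le: "(cmod (a + b))\<^sup>2 \<le> 2 * (cmod a)\<^sup>2 + 2 * (cmod b)\<^sup>2" for a b :: complex
  proof -
    have "(cmod (a + b))\<^sup>2 \<le> (cmod a + cmod b)\<^sup>2"
      by (intro power_mono norm_triangle_ineq) simp
    also have "\<dots> \<le> 2 * (cmod a)\<^sup>2 + 2 * (cmod b)\<^sup>2"
      using sum_squares_bound[of "cmod a" "cmod b"] by (simp add: power2_sum)
    finally show ?thesis .
  qed
  have "integrable circle (\<lambda>z. 2 * (cmod (f z))\<^sup>2 + 2 * (cmod (g z))\<^sup>2)"
    using f g by (auto simp: square_integrable_def)
  then have "integrable circle (\<lambda>z. (cmod (f z + g z))\<^sup>2)"
    by (rule Bochner_Integration.integrable_bound) (use le in auto)
  then show ?thesis by (simp add: square_integrable_def)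
qed

lemma square_integrable_scale:
  "square_integrable f \<Longrightarrow> square_integrable (\<lambda>z. c * f z)"
  by (auto simp: square_integrable_def norm_mult power_mult_distrib)

lemma square_integrable_Linf_mult:
  assumes \<phi>: "\<phi> \<in> Linf" and f: "square_integrable f"
  shows "square_integrable (\<lambda>z. \<phi> z * f z)"
proof -
  from \<phi> obtain B where [measurable]: "\<phi> \<in> borel_measurable circle"
    and B: "AE z in circle. cmod (\<phi> z) \<le> B"
    unfolding Linf_def by blast
  note [measurable] = square_integrable_measurable[OF f]
  have "integrable circle (\<lambda>z. B\<^sup>2 * (cmod (f z))\<^sup>2)"
    using f by (intro integrable_mult_right) (simp add: square_integrable_def)
  moreover have "AE z in circle. norm ((cmod (\<phi> z * f z))\<^sup>2) \<le> norm (B\<^sup>2 * (cmod (f z))\<^sup>2)"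
    using B
  proof eventually_elim
    case (elim z)
    then have "(cmod (\<phi> z))\<^sup>2 \<le> B\<^sup>2"
      by (rule power_mono) simp
    then have "(cmod (\<phi> z))\<^sup>2 * (cmod (f z))\<^sup>2 \<le> B\<^sup>2 * (cmod (f z))\<^sup>2"
      by (rule mult_right_mono) simp
    then show ?case
      by (simp only: norm_mult power_mult_distrib real_norm_def abs_mult abs_power2)
  qed
  moreover have "(\<lambda>z. (cmod (\<phi> z * f z))\<^sup>2) \<in> borel_measurable circle"
    by measurable
  ultimately have "integrable circle (\<lambda>z. (cmod (\<phi> z * f z))\<^sup>2)"
    by (blast intro: Bochner_Integration.integrable_bound)
  then show ?thesis
    unfolding square_integrable_def by (intro conjI) measurable
qed

lemma square_integrable_mult_cnj:
  assumes f: "square_integrable f" and g: "square_integrable g"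
  shows "integrable circle (\<lambda>z. f z * cnj (g z))"
proof -
  note [measurable] = square_integrable_measurable[OF f] square_integrable_measurable[OF g]
  have le: "cmod a * cmod b \<le> (cmod a)\<^sup>2 + (cmod b)\<^sup>2" for a b :: complex
  proof -
    have "0 \<le> cmod a * cmod b" by simp
    then show ?thesis
      using sum_squares_bound[of "cmod a" "cmod b"] by linarith
  qed
  have "integrable circle (\<lambda>z. (cmod (f z))\<^sup>2 + (cmod (g z))\<^sup>2)"
    using f g by (auto simp: square_integrable_def)
  then show ?thesis
    by (rule Bochner_Integration.integrable_bound) (use le in \<open>auto simp: norm_mult\<close>)
qed

quotient_type L2 = "complex \<Rightarrow> complex" /
  partial: "\<lambda>f g. square_integrable f \<and> square_integrable g \<and> (AE z in circle. f z = g z)"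
proof (rule part_equivpI)
  show "\<exists>f. square_integrable f \<and> square_integrable f \<and> (AE z in circle. f z = f z)"
    using square_integrable_zero by auto
  show "symp (\<lambda>f g. square_integrable f \<and> square_integrable g \<and> (AE z in circle. f z = g z))"
    by (auto simp: symp_def eq_commute)
  show "transp (\<lambda>f g. square_integrable f \<and> square_integrable g \<and> (AE z in circle. f z = g z))"
    unfolding transp_def
  proof (intro allI impI, elim conjE, intro conjI)
    fix f g h :: "complex \<Rightarrow> complex"
    assume "AE z in circle. f z = g z" "AE z in circle. g z = h z"
    then show "AE z in circle. f z = h z"
      by eventually_elim simp
  qed
qed

instantiation L2 :: ab_group_add
begin

lift_definition zero_L2 :: L2 is "\<lambda>_. 0"
  by (simp add: square_integrable_zero)

lift_definition plus_L2 :: "L2 \<Rightarrow> L2 \<Rightarrow> L2" is "\<lambda>f g z. f z + g z"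
proof (elim conjE, intro conjI)
  fix f f' g g' :: "complex \<Rightarrow> complex"
  assume "AE z in circle. f z = f' z" "AE z in circle. g z = g' z"
  then show "AE z in circle. f z + g z = f' z + g' z"
    by eventually_elim simp
qed (rule square_integrable_add; assumption)+

lift_definition uminus_L2 :: "L2 \<Rightarrow> L2" is "\<lambda>f z. - f z"
proof (elim conjE, intro conjI)
  fix f g :: "complex \<Rightarrow> complex"
  assume "AE z in circle. f z = g z"
  then show "AE z in circle. - f z = - g z"
    by eventually_elim simp
qed (drule square_integrable_scale[where c = "-1"]; simp)+

definition minus_L2 :: "L2 \<Rightarrow> L2 \<Rightarrow> L2" where
  "minus_L2 f g = f + - g"

instance
proof
  fix f g h :: L2
  show "f + g + h = f + (g + h)"
    by transfer (auto intro!: square_integrable_add simp: add.assoc)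
  show "f + g = g + f"
    by transfer (auto intro!: square_integrable_add simp: add.commute)
  show "0 + f = f"
    by transfer auto
  show "- f + f = 0"
    by transfer (auto simp: square_integrable_zero)
  show "f - g = f + - g"
    by (rule minus_L2_def)
qed

end

lift_definition scaleC :: "complex \<Rightarrow> L2 \<Rightarrow> L2" (infixr "*\<^sub>C" 75) is "\<lambda>c f z. c * f z"
proof (elim conjE, intro conjI)
  fix c and f g :: "complex \<Rightarrow> complex"
  assume "AE z in circle. f z = g z"
  then show "AE z in circle. c * f z = c * g z"
    by eventually_elim simp
qed (rule square_integrable_scale; assumption)+

interpretation L2: vector_space scaleC
proof
  fix a b :: complex and f g :: L2
  show "a *\<^sub>C (f + g) = a *\<^sub>C f + a *\<^sub>C g"
    by transfer (auto intro!: square_integrable_add square_integrable_scale simp: distrib_left)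
  show "(a + b) *\<^sub>C f = a *\<^sub>C f + b *\<^sub>C f"
    by transfer (auto intro!: square_integrable_add square_integrable_scale simp: distrib_right)
  show "a *\<^sub>C b *\<^sub>C f = (a * b) *\<^sub>C f"
    by transfer (auto intro!: square_integrable_scale simp: mult.assoc)
  show "1 *\<^sub>C f = f"
    by transfer auto
qed

text \<open>The inner product is linear in the first argument.\<close>

lift_definition cinner :: "L2 \<Rightarrow> L2 \<Rightarrow> complex" is
  "\<lambda>f g. integral\<^sup>L circle (\<lambda>z. f z * cnj (g z))"
proof (elim conjE)
  fix f f' g g' :: "complex \<Rightarrow> complex"
  assume sq: "square_integrable f" "square_integrable f'" "square_integrable g" "square_integrable g'"
    and eq: "AE z in circle. f z = f' z" "AE z in circle. g z = g' z"
  note [measurable] = sq[THEN square_integrable_measurable]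
  have "AE z in circle. f z * cnj (g z) = f' z * cnj (g' z)"
    using eq by eventually_elim simp
  then show "integral\<^sup>L circle (\<lambda>z. f z * cnj (g z)) = integral\<^sup>L circle (\<lambda>z. f' z * cnj (g' z))"
    by (intro integral_cong_AE) measurable
qed

lift_definition fourier_coeff :: "L2 \<Rightarrow> int \<Rightarrow> complex" is
  "\<lambda>f n. integral\<^sup>L circle (\<lambda>z. f z * cnj (z powi n))"
proof (elim conjE, rule ext)
  fix f g :: "complex \<Rightarrow> complex" and n :: int
  assume sq: "square_integrable f" "square_integrable g" and eq: "AE z in circle. f z = g z"
  note [measurable] = sq[THEN square_integrable_measurable] powi_measurable_circle
  have "AE z in circle. f z * cnj (z powi n) = g z * cnj (z powi n)"
    using eq by eventually_elim simp
  then show "integral\<^sup>L circle (\<lambda>z. f z * cnj (z powi n)) = integral\<^sup>L circle (\<lambda>z. g z * cnj (z powi n))"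
    by (intro integral_cong_AE) measurable
qed

definition H2 :: "L2 set" where
  "H2 = {f. \<forall>n<0. fourier_coeff f n = 0}"

text \<open>The operator \<open>M\<^sub>\<phi>\<close> is only meaningful for symbols in \<^const>\<open>Linf\<close>; the value \<open>0\<close> for
  all other symbols is a dummy.\<close>

lift_definition mult_op :: "(complex \<Rightarrow> complex) \<Rightarrow> L2 \<Rightarrow> L2" is
  "\<lambda>\<phi> f. if \<phi> \<in> Linf then (\<lambda>z. \<phi> z * f z) else (\<lambda>_. 0)"
proof (elim conjE, intro conjI)
  fix \<phi> and f g :: "complex \<Rightarrow> complex"
  assume sq: "square_integrable f" "square_integrable g" and eq: "AE z in circle. f z = g z"
  show "AE z in circle. (if \<phi> \<in> Linf then \<lambda>z. \<phi> z * f z else (\<lambda>_. 0)) z =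
      (if \<phi> \<in> Linf then \<lambda>z. \<phi> z * g z else (\<lambda>_. 0)) z"
    using eq by eventually_elim simp
qed (auto intro: square_integrable_Linf_mult square_integrable_zero)

lemma square_in_Linf: "(\<lambda>z. z\<^sup>2) \<in> Linf" "(\<lambda>z. (cnj z)\<^sup>2) \<in> Linf"
proof -
  have "AE z in circle. cmod (z\<^sup>2) \<le> 1" "AE z in circle. cmod ((cnj z)\<^sup>2) \<le> 1"
    by (rule AE_I2, simp add: norm_power)+
  then show "(\<lambda>z. z\<^sup>2) \<in> Linf" "(\<lambda>z. (cnj z)\<^sup>2) \<in> Linf"
    unfolding Linf_def
    by (auto intro!: continuous_measurable_circle continuous_on_power continuous_on_cnj
        continuous_on_id simp del: complex_cnj_power)
qed

definition antilinear :: "(L2 \<Rightarrow> L2) \<Rightarrow> bool" where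
  "antilinear C \<longleftrightarrow> (\<forall>f g. C (f + g) = C f + C g) \<and> (\<forall>c f. C (c *\<^sub>C f) = cnj c *\<^sub>C C f)"

definition conjugation :: "(L2 \<Rightarrow> L2) \<Rightarrow> bool" where
  "conjugation C \<longleftrightarrow>
     antilinear C \<and> C \<circ> C = id \<and> (\<forall>f g. cinner (C f) (C g) = cinner g f)"

end

theory Submission
  imports Defs
begin

text \<open>If \<open>f \<in> H\<^sup>2\<close>, then \<open>z\<^sup>2\<^sup>kf \<in> H\<^sup>2\<close> and so \<open>z\<^sup>-\<^sup>2\<^sup>kCf = C (z\<^sup>2\<^sup>kf) \<in> H\<^sup>2\<close> for every \<open>k\<close>; hence all Fourier
  coefficients of \<open>Cf\<close> vanish. In particular \<open>C1 \<in> H\<^sup>2\<close>, and the same argument applied to \<open>C1\<close> shows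
  that all Fourier coefficients of \<open>C (C1) = 1\<close> vanish, which is absurd.\<close>

text \<open>On the circle \<open>z * cnj z = 1\<close>, so the factor \<open>z\<^sup>2\<close>
  cancels two powers of \<open>cnj z\<close> in the kernel \<open>cnj (z powi n)\<close>.\<close>

lemma fourier_coeff_mult_square:
  "fourier_coeff (mult_op (\<lambda>z. z\<^sup>2) f) n = fourier_coeff f (n - 2)"
proof (transfer fixing: n, elim conjE)
  fix f
  have "z\<^sup>2 * f z * cnj (z powi n) = f z * cnj (z powi (n - 2))" if "z \<in> space circle" for z
  proof -
    have "z \<noteq> 0" and zz: "z * cnj z = 1"
      using that by (auto simp: complex_norm_square[symmetric])
    have "z powi n = z powi (n - 2) * z\<^sup>2"
      using \<open>z \<noteq> 0\<close> power_int_add[of z "n - 2" 2] by simp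
    moreover have "z\<^sup>2 * cnj (z\<^sup>2) = 1"
      using zz by (simp flip: power_mult_distrib)
    ultimately show ?thesis by (simp add: algebra_simps del: complex_cnj_power)
  qed
  \<comment> \<open>Membership in \<open>Linf\<close> selects the genuine product rather than the
    dummy value of \<open>mult_op\<close>.\<close>
  then show "integral\<^sup>L circle (\<lambda>z. (if (\<lambda>z. z\<^sup>2) \<in> Linf then \<lambda>z. z\<^sup>2 * f z else (\<lambda>_. 0)) z *
      cnj (z powi n)) = integral\<^sup>L circle (\<lambda>z. f z * cnj (z powi (n - 2)))"
    by (simp only: square_in_Linf if_True cong: Bochner_Integration.integral_cong)
qed

text \<open>The factor \<open>(cnj z)\<^sup>2\<close> merges with the kernel
  \<open>cnj (z powi n)\<close>, as \<open>cnj\<close> is multiplicative.\<close>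

lemma fourier_coeff_mult_cnj_square:
  "fourier_coeff (mult_op (\<lambda>z. (cnj z)\<^sup>2) f) n = fourier_coeff f (n + 2)"
proof (transfer fixing: n, elim conjE)
  fix f
  have "(cnj z)\<^sup>2 * f z * cnj (z powi n) = f z * cnj (z powi (n + 2))"
    if "z \<in> space circle" for z
  proof -
    have "z \<noteq> 0" using that by auto
    then show ?thesis by (simp add: power_int_add)
  qed
  then show "integral\<^sup>L circle (\<lambda>z. (if (\<lambda>z. (cnj z)\<^sup>2) \<in> Linf then \<lambda>z. (cnj z)\<^sup>2 * f z else (\<lambda>_. 0)) z *
      cnj (z powi n)) = integral\<^sup>L circle (\<lambda>z. f z * cnj (z powi (n + 2)))"
    by (simp only: square_in_Linf if_True cong: Bochner_Integration.integral_cong)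
qed

lemma mult_square_H2: "f \<in> H2 \<Longrightarrow> mult_op (\<lambda>z. z\<^sup>2) f \<in> H2"
  by (simp add: H2_def fourier_coeff_mult_square)

lift_definition one_L2 :: L2 is "\<lambda>_. 1"
  using finite_measure.integrable_const[OF finite_measure_circle]
  by (simp add: square_integrable_def)

text \<open>A density given by a real-valued function is the form that
  \<open>integral_density\<close> accepts.\<close>

lemma uniform_measure_period_eq_density:
  "uniform_measure lborel {0..<2 * pi} =
    density lborel (\<lambda>t. ennreal (indicator {0..<2 * pi} t / (2 * pi)))"
proof -
  have "1 / ennreal (2 * pi) = ennreal (1 / (2 * pi))"
    using divide_ennreal[of 1 "2 * pi"] by simp
  then have "indicator {0..<2 * pi} t / emeasure lborel {0..<2 * pi} =
      ennreal (indicator {0..<2 * pi} t / (2 * pi))" for t :: real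
    by (simp split: split_indicator)
  then show ?thesis
    by (simp add: uniform_measure_def)
qed

text \<open>Pulled back along \<open>cis\<close>, this is the mean over a full period of a function
  whose antiderivative \<open>cis (n * t) / (\<i> * n)\<close> has the same period.\<close>

lemma integral_circle_powi:
  assumes "n \<noteq> 0"
  shows "integral\<^sup>L circle (\<lambda>z. z powi n) = 0"
proof -
  have [measurable]: "(\<lambda>t::real. cis (n * t)) \<in> borel_measurable borel"
    by (intro borel_measurable_continuous_onI continuous_on_cis continuous_intros)
  have "integral\<^sup>L circle (\<lambda>z. z powi n) =
      integral\<^sup>L (uniform_measure lborel {0..<2 * pi}) (\<lambda>t. cis t powi n)"
    using powi_measurable_circle[of n] unfolding circle_def
    by (intro integral_distr) (auto simp: circle_def cong: measurable_cong_sets)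
  also have "\<dots> = integral\<^sup>L (uniform_measure lborel {0..<2 * pi}) (\<lambda>t. cis (n * t))"
    by (simp add: cis_power_int)
  also have "\<dots> = (LINT t|lborel. (indicator {0..<2 * pi} t / (2 * pi)) *\<^sub>R cis (n * t))"
    unfolding uniform_measure_period_eq_density
    by (rule integral_density) (auto intro!: AE_I2)
  \<comment> \<open>The fundamental theorem of calculus is stated for closed intervals; adding the
    endpoint \<open>2 * pi\<close> changes the integrand only on a null set.\<close>
  also have "\<dots> = (LINT t|lborel. (1 / (2 * pi)) *\<^sub>R (indicator {0..2 * pi} t *\<^sub>R cis (n * t)))"
    by (intro integral_cong_AE)
      (use AE_lborel_singleton[of "2 * pi"] in \<open>auto split: split_indicator elim!: eventually_mono\<close>)
  also have "\<dots> = (1 / (2 * pi)) *\<^sub>R (LINT t|lborel. indicator {0..2 * pi} t *\<^sub>R cis (n * t))"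
    by (rule integral_scaleR_right)
  also have "(LINT t|lborel. indicator {0..2 * pi} t *\<^sub>R cis (n * t)) =
      cis (n * (2 * pi)) / (\<i> * n) - cis (real_of_int n * 0) / (\<i> * n)"
  proof (rule integral_FTC_atLeastAtMost)
    show "((\<lambda>t. cis (n * t) / (\<i> * n)) has_vector_derivative cis (n * t))
        (at t within {0..2 * pi})" for t :: real
    proof -
      have "((\<lambda>t. exp (\<i> * n * complex_of_real t) / (\<i> * n)) has_vector_derivative
          exp (\<i> * n * complex_of_real t)) (at t within {0..2 * pi})"
        using assms by (auto intro!: derivative_eq_intros has_vector_derivative_real_field)
      then show ?thesis
        by (simp add: cis_conv_exp mult.assoc)
    qed
    show "continuous_on {0..2 * pi} (\<lambda>t. cis (n * t))"
      by (intro continuous_intros continuous_on_cis)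
  qed simp
  also have "cis (n * (2 * pi)) = 1"
    by (metis cis_multiple_2pi Ints_of_int mult.commute)
  finally show ?thesis by simp
qed

lemma fourier_coeff_one: "fourier_coeff one_L2 n = (if n = 0 then 1 else 0)"
proof (transfer fixing: n)
  \<comment> \<open>Conjugation reduces \<open>n \<noteq> 0\<close> to
    \<open>integral_circle_powi\<close>; for \<open>n = 0\<close> the integral is the total mass
    1.\<close>
  have "integral\<^sup>L circle (\<lambda>z. cnj (z powi n)) = cnj (integral\<^sup>L circle (\<lambda>z. z powi n))"
    by (rule Bochner_Integration.integral_cnj)
  then show "integral\<^sup>L circle (\<lambda>z. 1 * cnj (z powi n)) = (if n = 0 then 1 else 0)"
    using emeasure_space_circle by (simp add: integral_circle_powi measure_def)
qed

lemma one_in_H2: "one_L2 \<in> H2"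
  by (simp add: H2_def fourier_coeff_one)

lemma fourier_coeff_intertwiner:
  assumes comm: "C \<circ> mult_op (\<lambda>z. z\<^sup>2) = mult_op (\<lambda>z. (cnj z)\<^sup>2) \<circ> C"
    and H2: "C ` H2 \<subseteq> H2" and f: "f \<in> H2"
  shows "fourier_coeff (C f) n = 0"
proof -
  \<comment> \<open>\<open>k\<close> bounds the number of downward shifts by 2 that make the index
    negative, where \<open>C f \<in> H2\<close> applies. \<open>f\<close> must vary, since each
    shift replaces it by its product with \<open>z\<^sup>2\<close>.\<close>
  have "fourier_coeff (C f) n = 0" if "f \<in> H2" "n < 2 * int k" for f n k
    using that
  proof (induction k arbitrary: f n)
    case 0
    then show ?case using H2 by (auto simp: H2_def)
  next
    case (Suc k)
    have "fourier_coeff (C f) n = fourier_coeff (C (mult_op (\<lambda>z. z\<^sup>2) f)) (n - 2)"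
      using fun_cong[OF comm, of f] by (simp add: fourier_coeff_mult_cnj_square)
    also have "\<dots> = 0"
      using Suc.prems by (intro Suc.IH mult_square_H2) auto
    finally show ?case .
  qed
  \<comment> \<open>Any \<open>k\<close> with \<open>n < 2 * k\<close> would do;
    \<open>\<bar>n\<bar> + 1\<close> is one for either sign of \<open>n\<close>.\<close>
  from this[OF f, of n "nat (\<bar>n\<bar> + 1)"] show ?thesis by simp
qed

theorem theorem5p1:
  shows "\<not> (\<exists>C :: L2 \<Rightarrow> L2. conjugation C \<and>
           C \<circ> mult_op (\<lambda>z. z\<^sup>2) = mult_op (\<lambda>z. (cnj z)\<^sup>2) \<circ> C \<and>
           C ` H2 \<subseteq> H2)"
proof (intro notI, elim exE conjE)
  fix C :: "L2 \<Rightarrow> L2"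
  assume "conjugation C" and H2: "C ` H2 \<subseteq> H2"
    and comm: "C \<circ> mult_op (\<lambda>z. z\<^sup>2) = mult_op (\<lambda>z. (cnj z)\<^sup>2) \<circ> C"
  then have "C (C one_L2) = one_L2"
    by (metis conjugation_def comp_apply id_apply)
  moreover have "C one_L2 \<in> H2"
    using H2 one_in_H2 by blast
  \<comment> \<open>Index 0 is where the constant function has its only nonzero coefficient.\<close>
  ultimately show False
    using fourier_coeff_intertwiner[OF comm H2, of "C one_L2" 0] by (simp add: fourier_coeff_one)
qed

end
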